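(* Let $n\ge 2$ and let $(q,m)$ be a planar balanced collisionless central configuration with the primaries in the associated rigid motion. Put $s_i=|q_i|$ and $E_{min}=-\sum_{i=1}^n m_i/s_i$. For $E_{min}<E<0$ let $T_0(E)$ denote the minimal period of a solution with energy $E$ of $$\ddot z=-\sum_{i=1}^n\frac{m_iz}{(s_i^2+z^2)^{3/2}},$$ where the energy is $\frac{\dot z^2}{2}-\sum_{i=1}^n\frac{m_i}{(s_i^2+z^2)^{1/2}}$. Then: 1. If $z_E$ is the only positive solution of $-\sum_{i=1}^n m_i(s_i^2+z_E^2)^{-1/2}=E$, then $$T_0(E)=2^{3/2}\int_0^{z_E}\left(E+\sum_{i=1}^n m_i(s_i^2+z^2)^{-1/2}\right)^{-1/2}dz.$$ 2. $T_0(E)$ is an increasing function of $E$. 3. $T_0\big((E_{min},0)\big)=(T_{min},+\infty)$, where $T_{min}=2\pi\left(\sum_{i=1}^n\frac{m_i}{s_i^3}\right)^{-1/2}$.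
   Context: Masses are positive, positions $q_i$ are pairwise distinct points of the plane $\Pi=\{z=0\}\subset\mathbb{R}^3$, center of mass at the origin, gravitational constant $1$. Central configuration: there is $\lambda\in\mathbb{R}$ with $\nabla_jU(q)+\lambda m_jq_j=0$ for all $j$, where $U(q)=\sum_{i<j}\frac{m_im_j}{|q_i-q_j|}$. Balanced: for every $r>0$ such that $F_r:=\{i:|q_i|=r\}\ne\emptyset$, $\sum_{i\in F_r}m_iq_i=0$. Collisionless: $q_i\ne0$ for all $i$. Rigid motion: $x_j(t)=Q(\sqrt\lambda\, t)q_j$, with $Q(\theta)$ the rotation by angle $\theta$ about the $z$-axis. Solutions of the equation with energy in $(E_{min},0)$ are nonconstant and periodic. *)

theory Defs
  imports "HOL-Analysis.Analysis"
begin

text \<open>Bodies are indexed by \<open>{1..n}\<close>; values of \<open>m\<close> and \<open>q\<close> outside this set are irrelevant.\<close>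

definition planar_configuration :: "nat \<Rightarrow> (nat \<Rightarrow> real) \<Rightarrow> (nat \<Rightarrow> real^3) \<Rightarrow> bool" where
  "planar_configuration n m q \<longleftrightarrow>
     (\<forall>i\<in>{1..n}. m i > 0) \<and>
     inj_on q {1..n} \<and>
     (\<forall>i\<in>{1..n}. q i $ 3 = 0) \<and>
     (\<Sum>i=1..n. m i *\<^sub>R q i) = 0"

definition newton_potential :: "nat \<Rightarrow> (nat \<Rightarrow> real) \<Rightarrow> (nat \<Rightarrow> real^3) \<Rightarrow> real" where
  "newton_potential n m q = (\<Sum>j=1..n. \<Sum>i\<in>{1..<j}. m i * m j / norm (q i - q j))"

text \<open>
  The gradient with respect to the position of body \<open>j\<close> is the gradient of the potential
  as a function of that position alone, all other bodies being held fixed.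
\<close>

definition central_configuration_with ::
    "nat \<Rightarrow> (nat \<Rightarrow> real) \<Rightarrow> (nat \<Rightarrow> real^3) \<Rightarrow> real \<Rightarrow> bool" where
  "central_configuration_with n m q lam \<longleftrightarrow>
     (\<forall>j\<in>{1..n}. \<exists>g. (GDERIV (\<lambda>y. newton_potential n m (q(j := y))) (q j) :> g) \<and>
                      g + (lam * m j) *\<^sub>R q j = 0)"

definition balanced :: "nat \<Rightarrow> (nat \<Rightarrow> real) \<Rightarrow> (nat \<Rightarrow> real^3) \<Rightarrow> bool" where
  "balanced n m q \<longleftrightarrow>
     (\<forall>r>0. {i\<in>{1..n}. norm (q i) = r} \<noteq> {} \<longrightarrow>
            (\<Sum>i | i \<in> {1..n} \<and> norm (q i) = r. m i *\<^sub>R q i) = 0)"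

definition collisionless :: "nat \<Rightarrow> (nat \<Rightarrow> real^3) \<Rightarrow> bool" where
  "collisionless n q \<longleftrightarrow> (\<forall>i\<in>{1..n}. q i \<noteq> 0)"

definition rotation_z :: "real \<Rightarrow> real^3 \<Rightarrow> real^3" where
  "rotation_z \<theta> v =
     vector [cos \<theta> * v $ 1 - sin \<theta> * v $ 2, sin \<theta> * v $ 1 + cos \<theta> * v $ 2, v $ 3]"

definition rigid_motion :: "real \<Rightarrow> (nat \<Rightarrow> real^3) \<Rightarrow> nat \<Rightarrow> real \<Rightarrow> real^3" where
  "rigid_motion lam q j t = rotation_z (sqrt lam * t) (q j)"

text \<open>
  Global solutions \<open>z\<close> of the equation on the vertical axis, with velocity \<open>v\<close>, all of whose
  phase points have energy \<open>E\<close>.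
\<close>

definition solution_with_energy ::
    "nat \<Rightarrow> (nat \<Rightarrow> real) \<Rightarrow> (nat \<Rightarrow> real) \<Rightarrow> real \<Rightarrow> (real \<Rightarrow> real) \<Rightarrow> bool" where
  "solution_with_energy n m s E z \<longleftrightarrow>
     (\<exists>v. (\<forall>t. (z has_real_derivative v t) (at t)) \<and>
          (\<forall>t. (v has_real_derivative
                 - (\<Sum>i=1..n. m i * z t / ((s i)\<^sup>2 + (z t)\<^sup>2) powr (3/2))) (at t)) \<and>
          (\<forall>t. (v t)\<^sup>2 / 2 - (\<Sum>i=1..n. m i / ((s i)\<^sup>2 + (z t)\<^sup>2) powr (1/2)) = E))"

definition is_period :: "(real \<Rightarrow> real) \<Rightarrow> real \<Rightarrow> bool" where
  "is_period z T \<longleftrightarrow> T > 0 \<and> (\<forall>t. z (t + T) = z t)"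

definition is_minimal_period :: "(real \<Rightarrow> real) \<Rightarrow> real \<Rightarrow> bool" where
  "is_minimal_period z T \<longleftrightarrow> is_period z T \<and> (\<forall>S. is_period z S \<longrightarrow> T \<le> S)"

text \<open>
  Because of the definite description, an equation for \<open>minimal_period\<close> carries content only when
  solutions of energy \<open>E\<close> exist and they all have one and the same minimal period.
\<close>

definition minimal_period ::
    "nat \<Rightarrow> (nat \<Rightarrow> real) \<Rightarrow> (nat \<Rightarrow> real) \<Rightarrow> real \<Rightarrow> real" where
  "minimal_period n m s E =
     (THE T. \<exists>z. solution_with_energy n m s E z \<and> is_minimal_period z T)"

end

theory Submission
  imports Defs
begin

text \<open>
  Write \<open>U z = \<Sum>\<^sub>i m\<^sub>i / d\<^sub>i z\<close> with \<open>d\<^sub>i z = sqrt (s\<^sub>i\<^sup>2 + z\<^sup>2)\<close>, and parametrize the level of energy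
  \<open>E = - U a\<close> by \<open>z = a sin \<theta>\<close>. With \<open>A\<^sub>i = d\<^sub>i (a sin \<theta>)\<close> and \<open>B\<^sub>i = d\<^sub>i a\<close>,
  \[ U z - U a = a^2 \cos^2\theta \sum_i \frac{m_i}{A_i B_i (A_i + B_i)}, \]
  so the velocity is \<open>v = a cos \<theta> \<cdot> \<omega>\<close>, where \<open>\<omega>\<^sup>2\<close> is twice the sum on the right, and the motion becomes the
  regular equation \<open>\<theta>' = \<omega> (\<theta>)\<close>. The period is therefore four times the integral of \<open>1 / \<omega>\<close> over
  \<open>[0, \<pi>/2]\<close>, a proper integral. Both \<open>A\<^sub>i\<close> and \<open>B\<^sub>i\<close> increase with \<open>a\<close>, hence so does the period;
  at \<open>a = 0\<close> the integrand is constant and gives \<open>T\<^sub>m\<^sub>i\<^sub>n\<close>, and for large \<open>a\<close> it grows at least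
  linearly. Since the force is Lipschitz, every solution of energy \<open>E\<close> is a time shift of this one.
\<close>

section \<open>Antiderivatives and uniqueness for second-order equations\<close>

lemma antiderivative_on_reals:
  fixes f :: "real \<Rightarrow> real"
  assumes "continuous_on UNIV f"
  shows "\<exists>F. F 0 = 0 \<and> (\<forall>x. (F has_real_derivative f x) (at x))"
\<comment> \<open>An integral over \<open>{a..b}\<close> with \<open>b < a\<close> is 0, so this
  difference is the oriented integral from 0 to \<open>x\<close>.\<close>
proof (intro exI[of _ "\<lambda>x. integral {0..x} f - integral {x..0} f"] conjI allI)
  fix x :: real
  define F where "F x = integral {0..x} f - integral {x..0} f" for x
  define N where "N = \<bar>x\<bar> + 1"
  have int: "f integrable_on {a..b}" for a b
    by (meson assms continuous_on_subset integrable_continuous_real subset_UNIV)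
  \<comment> \<open>Near \<open>x\<close> the oriented integral differs by a constant from one with
    fixed lower limit \<open>-N\<close>, to which the fundamental theorem applies. \<open>N\<close>
    exceeds \<open>\<bar>x\<bar>\<close>, so \<open>x\<close> is interior.\<close>
  have F_eq: "F y = integral {-N..y} f - integral {-N..0} f" if "y \<in> {-N<..<N}" for y
  proof (cases "0 \<le> y")
    case True
    have "integral {-N..0} f + integral {0..y} f = integral {-N..y} f"
      using True N_def by (intro Henstock_Kurzweil_Integration.integral_combine int) auto
    moreover have "integral {y..0} f = 0"
      using True by (cases "y = 0") auto
    ultimately show ?thesis by (simp add: F_def)
  next
    case False
    have "integral {-N..y} f + integral {y..0} f = integral {-N..0} f"
      using False that by (intro Henstock_Kurzweil_Integration.integral_combine int) auto
    then show ?thesis using False by (simp add: F_def)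
  qed
  have x: "x \<in> {-N<..<N}" by (auto simp: N_def)
  have "((\<lambda>y. integral {-N..y} f) has_real_derivative f x) (at x within {-N..N})"
    using x by (intro integral_has_real_derivative continuous_on_subset[OF assms]) auto
  then have "((\<lambda>y. integral {-N..y} f) has_real_derivative f x) (at x)"
    using x by (simp add: at_within_Icc_at)
  then have "((\<lambda>y. integral {-N..y} f - integral {-N..0} f) has_real_derivative f x) (at x)"
    by (auto intro!: derivative_eq_intros)
  then have "(F has_real_derivative f x) (at x)"
    by (rule has_field_derivative_transform_within_open[where S = "{-N<..<N}"])
      (use x F_eq in auto)
  then show "((\<lambda>x. integral {0..x} f - integral {x..0} f) has_real_derivative f x) (at x)"
    by (simp add: F_def[abs_def])
qed simp

lemma has_real_derivative_inverse_bij: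
  fixes f :: "real \<Rightarrow> real"
  assumes "bij f" and deriv: "\<And>x. (f has_real_derivative f' x) (at x)" and "f' (inv f y) \<noteq> 0"
  shows "(inv f has_real_derivative inverse (f' (inv f y))) (at y)"
proof (rule DERIV_inverse_function[where a = "y - 1" and b = "y + 1"])
  have "isCont (inv f) (f (inv f y))"
    by (rule isCont_inverse_function2[where a = "inv f y - 1" and b = "inv f y + 1"])
      (use assms in \<open>auto intro: DERIV_isCont simp: bij_is_inj\<close>)
  then show "isCont (inv f) y"
    using assms(1) by (simp add: bij_is_surj surj_f_inv_f)
qed (use assms in \<open>auto simp: bij_is_surj surj_f_inv_f\<close>)

text \<open>Gronwall argument: the squared phase distance \<open>D\<close> satisfies
  \<open>\<bar>D'\<bar> \<le> C * D\<close>. So \<open>D t * exp (- C * t)\<close> cannot grow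
  forward from its value 0 at time 0, and \<open>D t * exp (C * t)\<close> cannot grow
  backward.\<close>

lemma second_order_uniqueness:
  fixes f z1 z2 v1 v2 :: "real \<Rightarrow> real"
  assumes lipschitz: "\<And>x y. \<bar>f x - f y\<bar> \<le> L * \<bar>x - y\<bar>"
    and z1: "\<And>t. (z1 has_real_derivative v1 t) (at t)"
    and v1: "\<And>t. (v1 has_real_derivative f (z1 t)) (at t)"
    and z2: "\<And>t. (z2 has_real_derivative v2 t) (at t)"
    and v2: "\<And>t. (v2 has_real_derivative f (z2 t)) (at t)"
    and "z1 0 = z2 0" "v1 0 = v2 0"
  shows "z1 t = z2 t"
proof -
  define D where "D t = (z1 t - z2 t)\<^sup>2 + (v1 t - v2 t)\<^sup>2" for t
  define D' where "D' t = 2 * (z1 t - z2 t) * (v1 t - v2 t)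
      + 2 * (v1 t - v2 t) * (f (z1 t) - f (z2 t))" for t
  \<comment> \<open>The two terms of \<open>D'\<close> contribute \<open>2 d e\<close> and
    \<open>2 \<bar>L\<bar> d e\<close>, with \<open>d\<close>, \<open>e\<close> the distances in
    position and velocity, and \<open>2 d e \<le> d\<^sup>2 + e\<^sup>2 = D\<close>.\<close>
  define C where "C = 1 + \<bar>L\<bar>"
  have D: "(D has_real_derivative D' t) (at t)" for t
    unfolding D_def D'_def
    by (rule derivative_eq_intros refl z1 v1 z2 v2)+ (simp add: algebra_simps)
  have bound: "\<bar>D' t\<bar> \<le> C * D t" for t
  proof -
    let ?d = "\<bar>z1 t - z2 t\<bar>" and ?e = "\<bar>v1 t - v2 t\<bar>"
    have "\<bar>f (z1 t) - f (z2 t)\<bar> \<le> \<bar>L\<bar> * ?d"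
      using lipschitz[of "z1 t" "z2 t"] by (meson abs_ge_self abs_ge_zero mult_right_mono order_trans)
    then have "2 * ?e * \<bar>f (z1 t) - f (z2 t)\<bar> \<le> 2 * ?e * (\<bar>L\<bar> * ?d)"
      by (intro mult_left_mono) auto
    moreover have "\<bar>D' t\<bar> \<le> 2 * ?d * ?e + 2 * ?e * \<bar>f (z1 t) - f (z2 t)\<bar>"
      unfolding D'_def by (rule order_trans[OF abs_triangle_ineq]) (simp only: abs_mult abs_numeral order_refl)
    ultimately have "\<bar>D' t\<bar> \<le> C * (2 * ?d * ?e)" by (simp add: C_def algebra_simps)
    also have "\<dots> \<le> C * D t"
      using sum_squares_bound[of ?d ?e] by (intro mult_left_mono) (auto simp: C_def D_def)
    finally show ?thesis .
  qed
  have D0: "D 0 = 0" using assms by (simp add: D_def)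
  have "D t \<le> 0"
  proof (cases "0 \<le> t")
    case True
    have "D t * exp (- C * t) \<le> D 0 * exp (- C * 0)"
    proof (rule DERIV_nonpos_imp_nonincreasing[where f = "\<lambda>t. D t * exp (- C * t)", OF True])
      fix x
      have "((\<lambda>t. D t * exp (- C * t)) has_real_derivative (D' x - C * D x) * exp (- C * x)) (at x)"
        by (rule derivative_eq_intros refl D)+ (simp add: algebra_simps)
      moreover have "(D' x - C * D x) * exp (- C * x) \<le> 0"
        using bound[of x] by (intro mult_nonpos_nonneg) auto
      ultimately show "\<exists>y. ((\<lambda>t. D t * exp (- C * t)) has_real_derivative y) (at x) \<and> y \<le> 0"
        by blast
    qed
    then show ?thesis by (simp add: D0 mult_le_0_iff)
  next
    case False
    have "D t * exp (C * t) \<le> D 0 * exp (C * 0)"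
    proof (rule DERIV_nonneg_imp_nondecreasing[where f = "\<lambda>t. D t * exp (C * t)"])
      show "t \<le> 0" using False by simp
      fix x
      have "((\<lambda>t. D t * exp (C * t)) has_real_derivative (D' x + C * D x) * exp (C * x)) (at x)"
        by (rule derivative_eq_intros refl D)+ (simp add: algebra_simps)
      moreover have "(D' x + C * D x) * exp (C * x) \<ge> 0"
        using bound[of x] by (intro mult_nonneg_nonneg) auto
      ultimately show "\<exists>y. ((\<lambda>t. D t * exp (C * t)) has_real_derivative y) (at x) \<and> y \<ge> 0"
        by blast
    qed
    then show ?thesis by (simp add: D0 mult_le_0_iff)
  qed
  then have "(z1 t - z2 t)\<^sup>2 = 0"
    unfolding D_def by (smt (verit) zero_le_power2)
  then show ?thesis by simp
qed

section \<open>The potential on the axis\<close>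

locale axis_potential =
  fixes n :: nat and m s :: "nat \<Rightarrow> real"
  assumes n_pos: "n \<ge> 1"
    and m_pos: "\<And>i. i \<in> {1..n} \<Longrightarrow> m i > 0"
    and s_pos: "\<And>i. i \<in> {1..n} \<Longrightarrow> s i > 0"
begin

definition dst :: "nat \<Rightarrow> real \<Rightarrow> real" where
  "dst i z = sqrt ((s i)\<^sup>2 + z\<^sup>2)"

definition pot :: "real \<Rightarrow> real" where
  "pot z = (\<Sum>i=1..n. m i / dst i z)"

definition force :: "real \<Rightarrow> real" where
  "force z = - (\<Sum>i=1..n. m i * z / dst i z ^ 3)"

lemma dst_pos [simp]: "i \<in> {1..n} \<Longrightarrow> dst i z > 0"
  using s_pos[of i] by (simp add: dst_def add_pos_nonneg)

lemma dst_nonneg [simp]: "dst i z \<ge> 0"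
  by (simp add: dst_def)

lemma dst_sq: "(dst i z)\<^sup>2 = (s i)\<^sup>2 + z\<^sup>2"
  by (simp add: dst_def)

lemma dst_0 [simp]: "i \<in> {1..n} \<Longrightarrow> dst i 0 = s i"
  using s_pos by (simp add: dst_def less_imp_le)

lemma dst_strict_mono: "\<bar>y\<bar> < \<bar>z\<bar> \<Longrightarrow> dst i y < dst i z"
  unfolding dst_def using power_strict_mono[of "\<bar>y\<bar>" "\<bar>z\<bar>" 2] by simp

lemma dst_mono: "\<bar>y\<bar> \<le> \<bar>z\<bar> \<Longrightarrow> dst i y \<le> dst i z"
  by (simp add: dst_def flip: abs_le_square_iff)

lemma s_le_dst: "i \<in> {1..n} \<Longrightarrow> s i \<le> dst i z"
  using dst_mono[of 0 z i] by simp

lemma abs_le_dst: "\<bar>z\<bar> \<le> dst i z"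
  unfolding dst_def by (rule real_le_rsqrt) simp

lemma continuous_on_dst [continuous_intros]:
  "continuous_on A f \<Longrightarrow> continuous_on A (\<lambda>x. dst i (f x))"
  unfolding dst_def by (intro continuous_intros)

lemma sum_pos_index: "(\<And>i. i \<in> {1..n} \<Longrightarrow> (f i :: real) > 0) \<Longrightarrow> (\<Sum>i=1..n. f i) > 0"
  using n_pos by (intro sum_pos) auto

lemma sum_strict_mono_index:
  "(\<And>i. i \<in> {1..n} \<Longrightarrow> (f i :: real) < g i) \<Longrightarrow> (\<Sum>i=1..n. f i) < (\<Sum>i=1..n. g i)"
  using n_pos by (intro sum_strict_mono) auto

lemma pot_pos: "pot z > 0"
  unfolding pot_def by (intro sum_pos_index divide_pos_pos m_pos dst_pos)

lemma pot_strict_antimono: "\<bar>y\<bar> < \<bar>z\<bar> \<Longrightarrow> pot z < pot y"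
  unfolding pot_def
  by (intro sum_strict_mono_index divide_strict_left_mono mult_pos_pos dst_strict_mono dst_pos m_pos)

lemma continuous_on_pot: "continuous_on A pot"
  unfolding pot_def[abs_def]
  by (intro continuous_intros ballI less_imp_neq[THEN not_sym] dst_pos)

lemma ex1_amplitude:
  assumes "0 < e" "e < pot 0"
  shows "\<exists>!a. a > 0 \<and> pot a = e"
proof -
  \<comment> \<open>Since \<open>dst i b \<ge> b\<close>, the potential at \<open>b\<close> is at
    most the total mass over \<open>b\<close>, which is \<open>e\<close> for this choice: the right
    end for the intermediate value theorem.\<close>
  define b where "b = (\<Sum>i=1..n. m i) / e"
  have msum: "(\<Sum>i=1..n. m i) > 0" by (intro sum_pos_index m_pos)
  then have b: "b > 0" using assms by (simp add: b_def)
  have "pot b \<le> (\<Sum>i=1..n. m i / b)"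
    unfolding pot_def using b abs_le_dst[of b]
    by (intro sum_mono divide_left_mono) (auto intro!: mult_pos_pos less_imp_le[OF m_pos])
  also have "\<dots> = e" using msum assms unfolding sum_divide_distrib[symmetric] by (simp add: b_def)
  finally have "pot b \<le> e" .
  then obtain a where "0 \<le> a" "a \<le> b" "pot a = e"
    using IVT2'[of pot b e 0] continuous_on_pot b assms by auto
  then have "a > 0" using assms by (cases "a = 0") auto
  show ?thesis
  proof (intro ex1I[of _ a] conjI)
    fix b assume "b > 0 \<and> pot b = e"
    then show "b = a"
      using pot_strict_antimono[of a b] pot_strict_antimono[of b a] \<open>a > 0\<close> \<open>pot a = e\<close>
      by (cases a b rule: linorder_cases) auto
  qed fact+
qed

text \<open>The derivative is bounded, because
  \<open>\<bar>s\<^sup>2 - 2 z\<^sup>2\<bar> \<le> 2 d\<^sup>2\<close> and \<open>d \<ge> s\<close>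
  for \<open>d = sqrt (s\<^sup>2 + z\<^sup>2)\<close>. This supplies the hypothesis of
  \<open>second_order_uniqueness\<close>.\<close>

lemma force_lipschitz: "\<bar>force x - force y\<bar> \<le> (\<Sum>i=1..n. 2 * m i / s i ^ 3) * \<bar>x - y\<bar>"
proof -
  define f' where "f' z = - (\<Sum>i=1..n. m i * ((s i)\<^sup>2 - 2 * z\<^sup>2) / dst i z ^ 5)" for z
  have deriv: "(force has_real_derivative f' z) (at z)" for z
  proof -
    have "((\<lambda>z. m i * z / dst i z ^ 3) has_real_derivative
        m i * ((s i)\<^sup>2 - 2 * z\<^sup>2) / dst i z ^ 5) (at z)" if "i \<in> {1..n}" for i
    proof -
      have p: "(s i)\<^sup>2 + z\<^sup>2 > 0" using s_pos[OF that] by (simp add: add_pos_nonneg)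
      have d: "(dst i has_real_derivative z / dst i z) (at z)"
        unfolding dst_def[abs_def] using p
        by (auto intro!: derivative_eq_intros simp: field_simps)
      have nz: "dst i z \<noteq> 0" using dst_pos[OF that, of z] by simp
      have "((\<lambda>z. m i * z / dst i z ^ 3) has_real_derivative
        m i * ((dst i z)\<^sup>2 - 3 * z\<^sup>2) / dst i z ^ 5) (at z)"
        using nz by (auto intro!: derivative_eq_intros d simp: field_simps power_eq_if)
      then show ?thesis by (simp add: dst_sq)
    qed
    then show ?thesis unfolding force_def[abs_def] f'_def by (intro DERIV_minus DERIV_sum)
  qed
  have bound: "\<bar>f' z\<bar> \<le> (\<Sum>i=1..n. 2 * m i / s i ^ 3)" for z
  proof -
    have "\<bar>m i * ((s i)\<^sup>2 - 2 * z\<^sup>2) / dst i z ^ 5\<bar> \<le> 2 * m i / s i ^ 3" if "i \<in> {1..n}" for i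
    proof -
      have d: "dst i z > 0" using that by simp
      have "\<bar>(s i)\<^sup>2 - 2 * z\<^sup>2\<bar> \<le> 2 * (dst i z)\<^sup>2"
        by (auto simp: dst_sq abs_le_iff)
      then have "\<bar>m i * ((s i)\<^sup>2 - 2 * z\<^sup>2) / dst i z ^ 5\<bar> \<le> m i * (2 * (dst i z)\<^sup>2) / dst i z ^ 5"
        using m_pos[OF that] d by (simp add: abs_mult divide_right_mono)
      also have "\<dots> = 2 * m i / dst i z ^ 3"
        using d by (simp add: field_simps power_eq_if)
      also have "\<dots> \<le> 2 * m i / s i ^ 3"
        using m_pos[OF that] d s_pos[OF that] s_le_dst[OF that, of z]
        by (intro divide_left_mono power_mono) auto
      finally show ?thesis .
    qed
    then show ?thesis
      unfolding f'_def abs_minus_cancel by (intro order_trans[OF sum_abs] sum_mono)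
  qed
  show ?thesis
    using field_differentiable_bound[of UNIV force f' "\<Sum>i=1..n. 2 * m i / s i ^ 3" x y] deriv bound
    by simp
qed

section \<open>The angular velocity on an energy level\<close>

text \<open>With \<open>pot\<close> regarded as a function of the square of its argument, this is
  minus the slope of its chord between \<open>(a * sin \<theta>)\<^sup>2\<close> and
  \<open>a\<^sup>2\<close>, in a closed form that stays meaningful when the two points
  merge.\<close>

definition chord :: "real \<Rightarrow> real \<Rightarrow> real" where
  "chord a \<theta> = (\<Sum>i=1..n. m i /
     (dst i (a * sin \<theta>) * dst i a * (dst i (a * sin \<theta>) + dst i a)))"

definition rate :: "real \<Rightarrow> real \<Rightarrow> real" where
  "rate a \<theta> = sqrt (2 * chord a \<theta>)"

text \<open>The time in which \<open>\<theta>' = rate a \<theta>\<close> runs from 0 to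
  \<open>pi/2\<close>, that is, from the center to the turning point. The value at
  \<open>a = 0\<close> is the limit of small oscillations.\<close>

definition quarter :: "real \<Rightarrow> real" where
  "quarter a = integral {0..pi/2} (\<lambda>\<theta>. 1 / rate a \<theta>)"

lemma chord_pos: "chord a \<theta> > 0"
  unfolding chord_def by (intro sum_pos_index divide_pos_pos mult_pos_pos add_pos_pos m_pos dst_pos)

lemma rate_pos [simp]: "rate a \<theta> > 0"
  by (simp add: rate_def chord_pos)

lemma rate_nonzero [simp]: "rate a \<theta> \<noteq> 0"
  by (rule less_imp_neq[OF rate_pos, THEN not_sym])

lemma rate_sq: "(rate a \<theta>)\<^sup>2 = 2 * chord a \<theta>"
  using chord_pos[of a \<theta>] by (simp add: rate_def)

text \<open>Termwise \<open>1/A - 1/B = (B - A) / (A B)\<close>, and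
  \<open>a\<^sup>2 cos\<^sup>2 \<theta> = B\<^sup>2 - A\<^sup>2\<close> contains the factor
  \<open>B - A\<close>.\<close>

lemma pot_diff: "pot (a * sin \<theta>) - pot a = (a * cos \<theta>)\<^sup>2 * chord a \<theta>"
proof -
  have "m i / dst i (a * sin \<theta>) - m i / dst i a =
      (a * cos \<theta>)\<^sup>2 * (m i / (dst i (a * sin \<theta>) * dst i a * (dst i (a * sin \<theta>) + dst i a)))"
    if "i \<in> {1..n}" for i
  proof -
    let ?A = "dst i (a * sin \<theta>)" and ?B = "dst i a"
    have pos: "?A > 0" "?B > 0" "?A + ?B > 0" using that by (auto intro: add_pos_pos)
    have "(a * cos \<theta>)\<^sup>2 = ?B\<^sup>2 - ?A\<^sup>2"
      by (simp add: dst_sq power_mult_distrib cos_squared_eq algebra_simps)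
    also have "\<dots> = (?B - ?A) * (?A + ?B)" by (simp add: power2_eq_square algebra_simps)
    finally have "(a * cos \<theta>)\<^sup>2 * (m i / (?A * ?B * (?A + ?B))) = (?B - ?A) * m i / (?A * ?B)"
      using pos by simp
    also have "\<dots> = m i / ?A - m i / ?B" using pos by (simp add: field_simps)
    finally show ?thesis ..
  qed
  then show ?thesis
    unfolding pot_def chord_def sum_distrib_left sum_subtractf[symmetric] by (rule sum.cong[OF refl])
qed

lemma continuous_on_rate:
  fixes A :: "'b::t2_space set"
  assumes "continuous_on A f" "continuous_on A g"
  shows "continuous_on A (\<lambda>x. rate (f x) (g x))"
  unfolding rate_def chord_def
  by (intro continuous_intros continuous_on_sin assms ballI less_imp_neq[THEN not_sym] mult_pos_pos add_pos_pos dst_pos)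

text \<open>Strictness comes from \<open>dst i a\<close> alone:
  \<open>dst i (a * sin \<theta>)\<close> does not change with \<open>a\<close> where
  \<open>sin \<theta> = 0\<close>.\<close>

lemma chord_strict_antimono:
  assumes "0 \<le> a" "a < b" shows "chord b \<theta> < chord a \<theta>"
  unfolding chord_def
proof (intro sum_strict_mono_index divide_strict_left_mono m_pos mult_pos_pos add_pos_pos dst_pos)
  fix i assume i: "i \<in> {1..n}"
  have A: "dst i (a * sin \<theta>) \<le> dst i (b * sin \<theta>)"
    using assms by (intro dst_mono) (simp add: abs_mult mult_right_mono)
  have B: "dst i a < dst i b"
    using assms by (intro dst_strict_mono) simp
  have "dst i (a * sin \<theta>) * dst i a < dst i (b * sin \<theta>) * dst i b"
    using A B dst_pos[OF i] by (intro mult_le_less_imp_less) simp_all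
  then show "dst i (a * sin \<theta>) * dst i a * (dst i (a * sin \<theta>) + dst i a)
      < dst i (b * sin \<theta>) * dst i b * (dst i (b * sin \<theta>) + dst i b)"
    by (rule mult_strict_mono'[OF _ add_le_less_mono[OF A B]]) simp_all
qed

lemma rate_strict_antimono: "0 \<le> a \<Longrightarrow> a < b \<Longrightarrow> rate b \<theta> < rate a \<theta>"
  by (simp add: rate_def chord_strict_antimono)

text \<open>The angle enters only through the square of its sine. The two symmetries make the four
  quarters of a turn equally long.\<close>

lemma rate_symmetric: "rate a (\<theta> + pi) = rate a \<theta>" "rate a (pi - \<theta>) = rate a \<theta>"
  by (simp_all add: rate_def chord_def dst_def)

text \<open>This is the frequency of the equation linearized at the equilibrium
  \<open>z = 0\<close>.\<close>

lemma rate_0: "rate 0 \<theta> = sqrt (\<Sum>i=1..n. m i / s i ^ 3)"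
proof -
  have "2 * (m i / (s i * s i * (s i + s i))) = m i / s i ^ 3" if "i \<in> {1..n}" for i
    using s_pos[OF that] by (simp add: field_simps power3_eq_cube)
  then have "2 * chord 0 \<theta> = (\<Sum>i=1..n. m i / s i ^ 3)"
    unfolding chord_def sum_distrib_left by (intro sum.cong) auto
  then show ?thesis by (simp add: rate_def)
qed

lemma rate_le_rate_0: "0 \<le> a \<Longrightarrow> rate a \<theta> \<le> rate 0 \<theta>"
  using rate_strict_antimono[of 0 a \<theta>] by (cases "a = 0") auto

text \<open>With \<open>z = a sin \<theta>\<close> and \<open>v = a cos \<theta> \<cdot> rate a \<theta>\<close>, this says that \<open>\<theta>' = rate a \<theta>\<close> gives
  \<open>v' = force z\<close>, also at the turning points \<open>cos \<theta> = 0\<close>.\<close>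

lemma velocity_derivative:
  "((\<lambda>\<theta>. a * cos \<theta> * rate a \<theta>) has_real_derivative force (a * sin \<theta>) / rate a \<theta>) (at \<theta>)"
proof -
  let ?A = "\<lambda>i \<theta>. dst i (a * sin \<theta>)" and ?B = "\<lambda>i. dst i a"
  \<comment> \<open>The termwise derivative of \<open>chord a\<close>: only \<open>A\<close> varies,
    with \<open>A' = a\<^sup>2 sin \<theta> cos \<theta> / A\<close>, and \<open>A B (A + B)\<close>
    has derivative \<open>B (2 A + B)\<close> in \<open>A\<close>.\<close>
  define c' where "c' = (\<Sum>i=1..n. - m i * (2 * ?A i \<theta> + ?B i) * (a\<^sup>2 * sin \<theta> * cos \<theta>) /
      (?A i \<theta> ^ 3 * ?B i * (?A i \<theta> + ?B i)\<^sup>2))"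
  have chord': "(chord a has_real_derivative c') (at \<theta>)"
    unfolding chord_def[abs_def] c'_def
  proof (rule DERIV_sum)
    fix i assume i: "i \<in> {1..n}"
    have pos: "?A i \<theta> > 0" "?B i > 0" "?A i \<theta> + ?B i > 0" using i by (auto intro: add_pos_pos)
    have "(s i)\<^sup>2 + (a * sin \<theta>)\<^sup>2 > 0" using s_pos[OF i] by (simp add: add_pos_nonneg)
    then have A': "(?A i has_real_derivative a\<^sup>2 * sin \<theta> * cos \<theta> / ?A i \<theta>) (at \<theta>)"
      unfolding dst_def[abs_def]
      by (auto intro!: derivative_eq_intros simp: field_simps power2_eq_square)
    show "((\<lambda>\<theta>. m i / (?A i \<theta> * ?B i * (?A i \<theta> + ?B i))) has_real_derivative
      - m i * (2 * ?A i \<theta> + ?B i) * (a\<^sup>2 * sin \<theta> * cos \<theta>) /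
      (?A i \<theta> ^ 3 * ?B i * (?A i \<theta> + ?B i)\<^sup>2)) (at \<theta>)"
      by (rule derivative_eq_intros refl A')+
        (use pos in \<open>auto simp: divide_simps power2_eq_square power3_eq_cube\<close>,
          simp add: algebra_simps)
  qed
  \<comment> \<open>Since \<open>rate\<close> squared is \<open>2 * chord\<close>, the claim reduces
    to this identity. The factor \<open>cos \<theta>\<close> in \<open>c'\<close> completes the
    square \<open>(a * cos \<theta>)\<^sup>2 = (B - A) * S\<close>, so there is no division by
    \<open>cos \<theta>\<close>; then \<open>B * S\<close> cancels and \<open>1 / A ^ 3\<close>
    remains.\<close>
  have identity: "a * (cos \<theta> * c' - 2 * sin \<theta> * chord a \<theta>) = force (a * sin \<theta>)"
  proof -
    have "a * (cos \<theta> * (- m i * (2 * ?A i \<theta> + ?B i) * (a\<^sup>2 * sin \<theta> * cos \<theta>) /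
          (?A i \<theta> ^ 3 * ?B i * (?A i \<theta> + ?B i)\<^sup>2)) -
        2 * sin \<theta> * (m i / (?A i \<theta> * ?B i * (?A i \<theta> + ?B i)))) = - (m i * (a * sin \<theta>) / ?A i \<theta> ^ 3)"
      if i: "i \<in> {1..n}" for i
    proof -
      obtain A B S where AB: "A = ?A i \<theta>" "B = ?B i" "S = A + B" by blast
      have pos: "A > 0" "B > 0" "S > 0" using i by (auto simp: AB intro: add_pos_pos)
      have sq: "(a * cos \<theta>)\<^sup>2 = (B - A) * S"
        by (simp add: AB power_mult_distrib cos_squared_eq algebra_simps
            flip: power2_eq_square) (simp add: dst_sq power_mult_distrib)
      have "a * (cos \<theta> * (- m i * (2 * A + B) * (a\<^sup>2 * sin \<theta> * cos \<theta>) / (A ^ 3 * B * S\<^sup>2)) -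
          2 * sin \<theta> * (m i / (A * B * S)))
        = - (m i * (a * sin \<theta>)) * ((2 * A + B) * (a * cos \<theta>)\<^sup>2 / (A ^ 3 * B * S\<^sup>2) + 2 / (A * B * S))"
        by (simp add: algebra_simps power2_eq_square)
      also have "(2 * A + B) * (a * cos \<theta>)\<^sup>2 / (A ^ 3 * B * S\<^sup>2) + 2 / (A * B * S)
          = ((2 * A + B) * (B - A) + 2 * A\<^sup>2) / (A ^ 3 * B * S)"
        unfolding sq using pos by (simp add: field_simps power2_eq_square power3_eq_cube)
      also have "(2 * A + B) * (B - A) + 2 * A\<^sup>2 = B * S"
        unfolding AB by (simp add: power2_eq_square algebra_simps)
      finally show ?thesis using pos by (simp add: AB)
    qed
    then show ?thesis
      unfolding c'_def chord_def force_def sum_negf[symmetric] sum_distrib_left sum_subtractf[symmetric]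
      by (rule sum.cong[OF refl])
  qed
  have "(rate a has_real_derivative c' / rate a \<theta>) (at \<theta>)"
    using chord_pos[of a \<theta>] unfolding rate_def[abs_def]
    by (auto intro!: derivative_eq_intros chord' simp: field_simps)
  then have "((\<lambda>\<theta>. a * cos \<theta> * rate a \<theta>) has_real_derivative
      a * cos \<theta> * (c' / rate a \<theta>) - a * sin \<theta> * rate a \<theta>) (at \<theta>)"
    by (auto intro!: derivative_eq_intros)
  also have "a * cos \<theta> * (c' / rate a \<theta>) - a * sin \<theta> * rate a \<theta> =
      a * (cos \<theta> * c' - sin \<theta> * (rate a \<theta>)\<^sup>2) / rate a \<theta>"
    by (simp add: field_simps power2_eq_square)
  also have "\<dots> = force (a * sin \<theta>) / rate a \<theta>"
    using identity by (simp add: rate_sq algebra_simps)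
  finally show ?thesis .
qed

section \<open>Dependence of the period on the amplitude\<close>

lemma quarter_0: "4 * quarter 0 = 2 * pi / sqrt (\<Sum>i=1..n. m i / s i ^ 3)"
  by (simp add: quarter_def rate_0)

text \<open>The integrand is jointly continuous, without singularity at the turning point or at
  \<open>a = 0\<close>, so this is continuity of a parameter integral over a compact
  interval.\<close>

lemma continuous_on_quarter: "continuous_on A quarter"
proof -
  have "continuous_on A (\<lambda>a. integral (cbox 0 (pi/2)) (\<lambda>\<theta>. 1 / rate a \<theta>))"
    by (rule integral_continuous_on_param)
      (auto simp: split_beta intro!: continuous_intros continuous_on_rate)
  then show ?thesis by (simp add: quarter_def[abs_def])
qed

lemma quarter_strict_mono: "0 \<le> a \<Longrightarrow> a < b \<Longrightarrow> quarter a < quarter b"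
  unfolding quarter_def
  by (intro integral_less_real continuous_intros continuous_on_rate divide_strict_left_mono
      rate_strict_antimono mult_pos_pos) (simp_all add: not_le)

text \<open>In the denominators of \<open>chord\<close>, the estimates \<open>A \<ge> s i\<close>,
  \<open>B \<ge> a\<close> and \<open>A + B \<ge> a\<close> bound \<open>rate\<close> by a constant
  over \<open>a\<close>. Hence the period is unbounded.\<close>

lemma quarter_lower_bound:
  assumes "a > 0"
  shows "a * (pi / 2 / sqrt (2 * (\<Sum>i=1..n. m i / s i))) \<le> quarter a"
proof -
  define M where "M = (\<Sum>i=1..n. m i / s i)"
  have M: "M > 0" unfolding M_def by (intro sum_pos_index divide_pos_pos m_pos s_pos)
  have "a / sqrt (2 * M) \<le> 1 / rate a \<theta>" for \<theta>
  proof -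
    have "chord a \<theta> \<le> (\<Sum>i=1..n. m i / (s i * a\<^sup>2))"
      unfolding chord_def
    proof (intro sum_mono divide_left_mono)
      fix i assume i: "i \<in> {1..n}"
      have "s i * a * a \<le> dst i (a * sin \<theta>) * dst i a * (dst i (a * sin \<theta>) + dst i a)"
        using i assms s_pos[OF i] s_le_dst[OF i, of "a * sin \<theta>"] abs_le_dst[of a i] dst_pos[OF i, of "a * sin \<theta>"]
        by (intro mult_mono) auto
      then show "s i * a\<^sup>2 \<le> dst i (a * sin \<theta>) * dst i a * (dst i (a * sin \<theta>) + dst i a)"
        by (simp add: power2_eq_square mult.assoc)
      show "0 \<le> m i" using m_pos[OF i] by simp
      show "0 < dst i (a * sin \<theta>) * dst i a * (dst i (a * sin \<theta>) + dst i a) * (s i * a\<^sup>2)"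
        using i assms s_pos[OF i] by (intro mult_pos_pos add_pos_pos) auto
    qed
    also have "\<dots> = M / a\<^sup>2" by (simp add: M_def sum_divide_distrib)
    finally have "rate a \<theta> \<le> sqrt (2 * M / a\<^sup>2)" by (simp add: rate_def)
    also have "\<dots> = sqrt (2 * M) / a" using assms by (simp add: real_sqrt_divide)
    finally show ?thesis using assms M by (simp add: field_simps)
  qed
  then have "integral {0..pi/2} (\<lambda>_. a / sqrt (2 * M)) \<le> quarter a"
    unfolding quarter_def
    by (intro integral_le integrable_continuous_real continuous_intros continuous_on_rate) auto
  then show ?thesis by (simp add: M_def mult.commute)
qed

lemma quarter_image: "(\<lambda>a. 4 * quarter a) ` {0<..} = {4 * quarter 0<..}"
proof (intro equalityI subsetI)
  fix T assume "T \<in> {4 * quarter 0<..}"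
  then have T: "quarter 0 < T / 4" by simp
  define c where "c = pi / 2 / sqrt (2 * (\<Sum>i=1..n. m i / s i))"
  have "(\<Sum>i=1..n. m i / s i) > 0" by (intro sum_pos_index divide_pos_pos m_pos s_pos)
  then have c: "c > 0" by (simp add: c_def)
  \<comment> \<open>At \<open>T / 4 / c\<close> the linear lower bound reaches \<open>T / 4\<close>;
    the maximum with 1 makes \<open>b\<close> evidently positive.\<close>
  define b where "b = max 1 (T / 4 / c)"
  have "b > 0" by (simp add: b_def)
  have "T / 4 \<le> b * c" using c by (simp add: b_def max_def field_simps)
  also have "\<dots> \<le> quarter b" using quarter_lower_bound[OF \<open>b > 0\<close>] by (simp add: c_def)
  finally obtain a where a: "0 \<le> a" "a \<le> b" "quarter a = T / 4"
    using IVT'[of quarter 0 "T / 4" b] T \<open>b > 0\<close> continuous_on_quarter by auto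
  moreover have "a \<noteq> 0" using a T by auto
  ultimately show "T \<in> (\<lambda>a. 4 * quarter a) ` {0<..}" by (intro image_eqI[of _ _ a]) auto
qed (use quarter_strict_mono in force)

section \<open>Motion and minimal period\<close>

text \<open>Time as a function of the angle. The value at 0 and the derivative determine it, so the
  choice is unique.\<close>

definition elapsed :: "real \<Rightarrow> real \<Rightarrow> real" where
  "elapsed a = (SOME F. F 0 = 0 \<and> (\<forall>\<theta>. (F has_real_derivative 1 / rate a \<theta>) (at \<theta>)))"

lemma elapsed_0 [simp]: "elapsed a 0 = 0"
  and elapsed_deriv: "(elapsed a has_real_derivative 1 / rate a \<theta>) (at \<theta>)"
proof -
  have "\<exists>F. F 0 = 0 \<and> (\<forall>\<theta>. (F has_real_derivative 1 / rate a \<theta>) (at \<theta>))"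
    by (intro antiderivative_on_reals continuous_intros continuous_on_rate) auto
  then have "elapsed a 0 = 0 \<and> (\<forall>\<theta>. (elapsed a has_real_derivative 1 / rate a \<theta>) (at \<theta>))"
    unfolding elapsed_def by (rule someI_ex)
  then show "elapsed a 0 = 0" "(elapsed a has_real_derivative 1 / rate a \<theta>) (at \<theta>)"
    by auto
qed

lemma continuous_on_elapsed: "continuous_on A (elapsed a)"
  by (meson DERIV_continuous_on elapsed_deriv has_field_derivative_at_within)

lemma elapsed_half_pi: "elapsed a (pi / 2) = quarter a"
proof -
  have "((\<lambda>\<theta>. 1 / rate a \<theta>) has_integral (elapsed a (pi / 2) - elapsed a 0)) {0..pi / 2}"
    by (intro fundamental_theorem_of_calculus_interior continuous_on_elapsed)
      (auto simp: elapsed_deriv simp flip: has_real_derivative_iff_has_vector_derivative)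
  then show ?thesis by (simp add: quarter_def integral_unique)
qed

text \<open>By the symmetries of \<open>rate\<close>, two combinations have derivative 0: the
  increment over a half turn is constant, and reflection at \<open>pi / 2\<close> shows that it
  consists of two quarters.\<close>

lemma elapsed_period: "elapsed a (\<theta> + 2 * pi) = elapsed a \<theta> + 4 * quarter a"
proof -
  have shift: "elapsed a (\<theta> + pi) = elapsed a \<theta> + elapsed a pi" for \<theta>
  proof -
    have "((\<lambda>\<theta>. elapsed a (\<theta> + pi) - elapsed a \<theta>) has_real_derivative 0) (at \<theta>)" for \<theta>
      using DERIV_shift[of "elapsed a" "1 / rate a \<theta>" \<theta> pi] elapsed_deriv[of a "\<theta> + pi"]
      by (auto intro!: derivative_eq_intros elapsed_deriv simp: rate_symmetric)
    from DERIV_isconst_all[OF allI, OF this, of \<theta> 0] show ?thesis by simp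
  qed
  have "((\<lambda>\<theta>. elapsed a (pi - \<theta>) + elapsed a \<theta>) has_real_derivative 0) (at \<theta>)" for \<theta>
    by (auto intro!: derivative_eq_intros elapsed_deriv DERIV_chain2[OF elapsed_deriv]
        simp: rate_symmetric)
  from DERIV_isconst_all[OF allI, OF this, of "pi / 2" 0]
  have "elapsed a pi = 2 * quarter a"
    by (simp add: elapsed_half_pi)
  then show ?thesis
    using shift[of \<theta>] shift[of "\<theta> + pi"] by (simp add: algebra_simps)
qed

lemma elapsed_strict_mono: "strict_mono (elapsed a)"
proof (rule strict_monoI)
  fix x y :: real assume "x < y"
  then show "elapsed a x < elapsed a y"
    by (rule DERIV_pos_imp_increasing) (use elapsed_deriv rate_pos in \<open>meson zero_less_divide_1_iff\<close>)
qed

text \<open>The slope is at least \<open>c > 0\<close>, as \<open>rate 0\<close> bounds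
  \<open>rate a\<close> and does not depend on the angle. So \<open>elapsed a\<close> tends to
  infinity in both directions, which makes the motion global in time.\<close>

lemma bij_elapsed:
  assumes "a > 0" shows "bij (elapsed a)"
proof -
  define c where "c = 1 / rate 0 0"
  have c: "c > 0" by (simp add: c_def)
  have rate: "c \<le> 1 / rate a \<theta>" for \<theta>
    using rate_le_rate_0[of a \<theta>] assms rate_0[of \<theta>] rate_0[of 0] rate_pos[of 0 0]
    unfolding c_def by (intro divide_left_mono mult_pos_pos) auto
  have growth: "elapsed a x - c * x \<le> elapsed a y - c * y" if "x \<le> y" for x y
  proof (rule DERIV_nonneg_imp_nondecreasing[where f = "\<lambda>x. elapsed a x - c * x", OF that])
    fix \<theta>
    have "((\<lambda>x. elapsed a x - c * x) has_real_derivative (1 / rate a \<theta> - c)) (at \<theta>)"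
      by (auto intro!: derivative_eq_intros elapsed_deriv)
    then show "\<exists>y. ((\<lambda>x. elapsed a x - c * x) has_real_derivative y) (at \<theta>) \<and> 0 \<le> y"
      using rate[of \<theta>] by (intro exI conjI) auto
  qed
  have "\<exists>x. elapsed a x = y" for y
  proof -
    define b where "b = \<bar>y\<bar> / c"
    have b: "b \<ge> 0" "c * b = \<bar>y\<bar>" using c by (simp_all add: b_def)
    have "elapsed a (- b) \<le> y" "y \<le> elapsed a b"
      using growth[of "- b" 0] growth[of 0 b] b by auto
    then show ?thesis
      using IVT'[of "elapsed a" "- b" y b] b continuous_on_elapsed by auto
  qed
  then show ?thesis
    using strict_mono_imp_inj_on[OF elapsed_strict_mono] by (metis bijI surjI surj_def)
qed

text \<open>For \<open>a > 0\<close> this is the solution of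
  \<open>\<theta>' = rate a \<theta>\<close> that starts at angle 0.\<close>

definition angle :: "real \<Rightarrow> real \<Rightarrow> real" where
  "angle a = inv (elapsed a)"

lemma elapsed_angle: "a > 0 \<Longrightarrow> elapsed a (angle a t) = t"
  and angle_elapsed: "a > 0 \<Longrightarrow> angle a (elapsed a \<theta>) = \<theta>"
  using bij_elapsed[of a] by (simp_all add: angle_def bij_is_surj surj_f_inv_f bij_is_inj)

lemma angle_deriv: "a > 0 \<Longrightarrow> (angle a has_real_derivative rate a (angle a t)) (at t)"
  unfolding angle_def
  using has_real_derivative_inverse_bij[OF bij_elapsed elapsed_deriv, of a t] by simp

lemma angle_less_iff: "a > 0 \<Longrightarrow> angle a t < angle a u \<longleftrightarrow> t < u"
  using strict_mono_less[OF elapsed_strict_mono, of a "angle a t" "angle a u"]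
  by (simp add: elapsed_angle)

lemma angle_period: "a > 0 \<Longrightarrow> angle a (t + 4 * quarter a) = angle a t + 2 * pi"
  using elapsed_period[of a "angle a t"] angle_elapsed[of a "angle a t + 2 * pi"]
  by (simp add: elapsed_angle)

section \<open>Solutions of the axis equation and their minimal period\<close>

lemma powr_three_halves: "x \<ge> 0 \<Longrightarrow> x powr (3/2) = sqrt x ^ 3" for x :: real
  by (cases "x = 0") (simp_all add: powr_half_sqrt_powr real_sqrt_power)

text \<open>At \<open>x = 0\<close> both sides are 0, by the conventions \<open>0 powr y = 0\<close>
  and \<open>1 / 0 = 0\<close>.\<close>

lemma powr_minus_half: "x \<ge> 0 \<Longrightarrow> x powr (- (1/2)) = 1 / sqrt x" for x :: real
  using powr_minus[of x "1/2"] by (simp add: powr_half_sqrt inverse_eq_divide)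

lemma pot_powr: "(\<Sum>i=1..n. m i * ((s i)\<^sup>2 + z\<^sup>2) powr (-1/2)) = pot z"
  by (simp add: pot_def dst_def powr_minus_half)

lemma solution_with_energy_iff:
  "solution_with_energy n m s E z \<longleftrightarrow>
     (\<exists>v. (\<forall>t. (z has_real_derivative v t) (at t)) \<and>
          (\<forall>t. (v has_real_derivative force (z t)) (at t)) \<and>
          (\<forall>t. (v t)\<^sup>2 / 2 - pot (z t) = E))"
  by (simp add: solution_with_energy_def force_def pot_def dst_def powr_three_halves powr_half_sqrt)

definition orbit :: "real \<Rightarrow> real \<Rightarrow> real" where
  "orbit a t = a * sin (angle a t)"

definition orbit_velocity :: "real \<Rightarrow> real \<Rightarrow> real" where
  "orbit_velocity a t = a * cos (angle a t) * rate a (angle a t)"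

lemma orbit_deriv: "a > 0 \<Longrightarrow> (orbit a has_real_derivative orbit_velocity a t) (at t)"
  unfolding orbit_def[abs_def] orbit_velocity_def
  by (auto intro!: derivative_eq_intros angle_deriv)

lemma orbit_velocity_deriv:
  "a > 0 \<Longrightarrow> (orbit_velocity a has_real_derivative force (orbit a t)) (at t)"
  unfolding orbit_def orbit_velocity_def[abs_def]
  using DERIV_chain2[OF velocity_derivative[of a] angle_deriv[of a t]] by simp

lemma orbit_energy: "(orbit_velocity a t)\<^sup>2 / 2 - pot (orbit a t) = - pot a"
  using pot_diff[of a "angle a t"]
  by (simp add: orbit_def orbit_velocity_def power_mult_distrib rate_sq)

lemma orbit_solution: "a > 0 \<Longrightarrow> solution_with_energy n m s (- pot a) (orbit a)"
  unfolding solution_with_energy_iff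
  using orbit_deriv orbit_velocity_deriv orbit_energy by blast

text \<open>The orbit runs through its whole energy level: the arcsine gives the point with
  nonnegative velocity above \<open>z\<close>, and the angle \<open>pi - \<alpha>\<close> gives the
  one with opposite velocity.\<close>

lemma energy_level_point:
  assumes "a > 0" and energy: "v\<^sup>2 / 2 - pot z = - pot a"
  obtains t where "z = orbit a t" "v = orbit_velocity a t"
proof -
  have "pot a \<le> pot z" using energy zero_le_power2[of v] by linarith
  then have "\<bar>z\<bar> \<le> a"
    using pot_strict_antimono[of a z] assms(1) by fastforce
  define \<alpha> where "\<alpha> = arcsin (z / a)"
  have sin: "a * sin \<alpha> = z"
    using \<open>\<bar>z\<bar> \<le> a\<close> assms(1) by (simp add: \<alpha>_def abs_le_iff field_simps)
  have "v\<^sup>2 = (a * cos \<alpha> * rate a \<alpha>)\<^sup>2"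
    using pot_diff[of a \<alpha>] energy by (simp add: sin power_mult_distrib rate_sq)
  then have "v = a * cos \<alpha> * rate a \<alpha> \<or> v = - (a * cos \<alpha> * rate a \<alpha>)"
    by (simp add: power2_eq_iff)
  then have "\<exists>\<theta>. a * sin \<theta> = z \<and> a * cos \<theta> * rate a \<theta> = v"
  proof
    assume "v = - (a * cos \<alpha> * rate a \<alpha>)"
    then show ?thesis using sin by (intro exI[of _ "pi - \<alpha>"]) (simp add: rate_symmetric)
  qed (use sin in auto)
  then obtain \<theta> where "a * sin \<theta> = z" "a * cos \<theta> * rate a \<theta> = v" by blast
  then show thesis
    using assms(1) by (intro that[of "elapsed a \<theta>"])
      (simp_all add: orbit_def orbit_velocity_def angle_elapsed)
qed

text \<open>The initial data lie on the orbit at some time \<open>c\<close>; the equation is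
  autonomous, so uniqueness identifies the solution with the shift by \<open>c\<close>.\<close>

lemma solution_is_shifted_orbit:
  assumes "a > 0" "solution_with_energy n m s (- pot a) z"
  obtains c where "z = (\<lambda>t. orbit a (t + c))"
proof -
  obtain v where z: "\<And>t. (z has_real_derivative v t) (at t)"
    and v: "\<And>t. (v has_real_derivative force (z t)) (at t)"
    and energy: "\<And>t. (v t)\<^sup>2 / 2 - pot (z t) = - pot a"
    using assms(2) unfolding solution_with_energy_iff by blast
  obtain c where c: "z 0 = orbit a c" "v 0 = orbit_velocity a c"
    by (rule energy_level_point[OF assms(1) energy])
  have "z t = orbit a (t + c)" for t
  proof (rule second_order_uniqueness[OF force_lipschitz z v])
    show "((\<lambda>t. orbit a (t + c)) has_real_derivative orbit_velocity a (t + c)) (at t)" for t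
      using orbit_deriv[OF assms(1)] by (simp flip: DERIV_shift)
    show "((\<lambda>t. orbit_velocity a (t + c)) has_real_derivative force (orbit a (t + c))) (at t)" for t
      using orbit_velocity_deriv[OF assms(1)] by (simp flip: DERIV_shift)
  qed (simp_all add: c)
  then show thesis using that by blast
qed

lemma minimal_period_shifted_orbit:
  assumes "a > 0"
  shows "is_minimal_period (\<lambda>t. orbit a (t + c)) (4 * quarter a)"
  unfolding is_minimal_period_def is_period_def
proof (intro conjI allI impI)
  have "elapsed a 0 < elapsed a (pi / 2)"
    by (intro strict_monoD[OF elapsed_strict_mono]) simp
  then show "0 < 4 * quarter a" by (simp add: elapsed_half_pi)
  have "t + 4 * quarter a + c = t + c + 4 * quarter a" for t by simp
  then show "orbit a (t + 4 * quarter a + c) = orbit a (t + c)" for t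
    by (simp only: orbit_def angle_period[OF assms] sin_periodic)
  fix S assume S: "0 < S \<and> (\<forall>t. orbit a (t + S + c) = orbit a (t + c))"
  \<comment> \<open>At this time the orbit is at its maximum. That value determines the angle modulo
    \<open>2 * pi\<close>, so a later return needs at least one full turn.\<close>
  define t where "t = quarter a"
  have t: "angle a t = pi / 2"
    using angle_elapsed[OF assms, of "pi / 2"] by (simp add: t_def elapsed_half_pi)
  have "orbit a (t - c + S + c) = orbit a (t - c + c)" using S by blast
  then have "sin (angle a (t + S)) = 1"
    using assms by (simp add: orbit_def t)
  then have "cos (angle a (t + S) - pi / 2) = 1" by (simp add: cos_diff)
  then obtain k :: int where k: "angle a (t + S) - pi / 2 = k * 2 * pi"
    using cos_one_2pi_int by auto
  have "angle a t < angle a (t + S)" using S assms by (simp add: angle_less_iff)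
  then have "0 < real_of_int k * (2 * pi)" using k t by linarith
  then have "k \<ge> 1" by (simp add: zero_less_mult_iff)
  then have "2 * pi \<le> real_of_int k * (2 * pi)" by simp
  then have "angle a t + 2 * pi \<le> angle a (t + S)" using k t by linarith
  then have "\<not> angle a (t + S) < angle a (t + 4 * quarter a)"
    using assms by (simp add: angle_period)
  then show "4 * quarter a \<le> S" using assms by (simp add: angle_less_iff)
qed

text \<open>The definite description is satisfied because all solutions of this energy are shifts of
  one orbit and a minimal period is unique.\<close>

lemma minimal_period_eq:
  assumes "a > 0"
  shows "minimal_period n m s (- pot a) = 4 * quarter a"
  unfolding minimal_period_def
proof (rule the_equality)
  show "\<exists>z. solution_with_energy n m s (- pot a) z \<and> is_minimal_period z (4 * quarter a)"
    using orbit_solution[OF assms] minimal_period_shifted_orbit[OF assms, of 0] by auto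
  fix T assume "\<exists>z. solution_with_energy n m s (- pot a) z \<and> is_minimal_period z T"
  then obtain c where "is_minimal_period (\<lambda>t. orbit a (t + c)) T"
    using solution_is_shifted_orbit[OF assms] by metis
  with minimal_period_shifted_orbit[OF assms, of c] show "T = 4 * quarter a"
    unfolding is_minimal_period_def by (meson order_antisym)
qed

text \<open>An antiderivative is \<open>sqrt 2 * elapsed a (arcsin (z / a))\<close>; the singularity at \<open>z = a\<close>
  is harmless because only the interior derivative is needed.\<close>

lemma quarter_has_integral:
  assumes "a > 0"
  shows "((\<lambda>z. (pot z - pot a) powr (-1/2)) has_integral (sqrt 2 * quarter a)) {0..a}"
proof -
  define F where "F z = sqrt 2 * elapsed a (arcsin (z / a))" for z
  have ratio: "-1 \<le> z / a \<and> z / a \<le> 1" if "0 \<le> z" "z \<le> a" for z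
  proof -
    have "0 \<le> z / a" "z / a \<le> 1" using that assms by simp_all
    then show ?thesis by linarith
  qed
  have "((\<lambda>z. (pot z - pot a) powr (-1/2)) has_integral (F a - F 0)) {0..a}"
  proof (rule fundamental_theorem_of_calculus_interior)
    show "continuous_on {0..a} F"
      unfolding F_def using assms
      by (intro continuous_intros continuous_on_compose2[OF continuous_on_elapsed[of UNIV]])
        (use ratio in auto)
    fix z assume z: "z \<in> {0<..<a}"
    define \<theta> where "\<theta> = arcsin (z / a)"
    have sin: "sin \<theta> = z / a" using ratio[of z] z by (simp add: \<theta>_def)
    have "(z / a)\<^sup>2 < 1" using z by (simp add: power_less_one_iff abs_square_less_1)
    then have cos: "cos \<theta> = sqrt (1 - (z / a)\<^sup>2)" "cos \<theta> > 0"
      using ratio[of z] z by (simp_all add: \<theta>_def cos_arcsin)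
    have "0 < z / a" "z / a < 1" using z by simp_all
    then have "-1 < z / a" by linarith
    have "((\<lambda>z. arcsin (z / a)) has_real_derivative inverse (cos \<theta>) * (1 / a)) (at z)"
      unfolding cos(1)
      by (rule DERIV_chain2[OF DERIV_arcsin[OF \<open>-1 < z / a\<close> \<open>z / a < 1\<close>] DERIV_cdivide[OF DERIV_ident]])
    then have "(F has_real_derivative sqrt 2 * (1 / rate a \<theta> * (inverse (cos \<theta>) * (1 / a)))) (at z)"
      unfolding F_def[abs_def] \<theta>_def by (intro DERIV_cmult DERIV_chain2[OF elapsed_deriv])
    \<comment> \<open>This is the substitution \<open>z = a sin \<theta>\<close>: by
      \<open>pot_diff\<close> the root of \<open>pot z - pot a\<close> is
      \<open>a * cos \<theta> * rate a \<theta> / sqrt 2\<close>.\<close>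
    also have "sqrt 2 * (1 / rate a \<theta> * (inverse (cos \<theta>) * (1 / a))) = (pot z - pot a) powr (-1/2)"
    proof -
      have "pot z - pot a = (a * cos \<theta>)\<^sup>2 * chord a \<theta>"
        using pot_diff[of a \<theta>] assms by (simp add: sin)
      then have "sqrt (pot z - pot a) = a * cos \<theta> * (rate a \<theta> / sqrt 2)"
        using assms cos by (simp add: real_sqrt_mult rate_def)
      moreover have "pot z - pot a \<ge> 0"
        using pot_strict_antimono[of z a] z by simp
      ultimately show ?thesis by (simp add: powr_minus_half inverse_eq_divide ac_simps)
    qed
    finally show "(F has_vector_derivative (pot z - pot a) powr (-1/2)) (at z)"
      by (simp add: has_real_derivative_iff_has_vector_derivative)
  qed (use assms in simp)
  then show ?thesis using assms by (simp add: F_def elapsed_half_pi)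
qed

end

section \<open>The period as a function of the energy\<close>

theorem theorem5:
  fixes n :: nat and m :: "nat \<Rightarrow> real" and q :: "nat \<Rightarrow> real^3" and lam :: real
    and x :: "nat \<Rightarrow> real \<Rightarrow> real^3"
    and s :: "nat \<Rightarrow> real" and Emin Tmin :: real and T0 :: "real \<Rightarrow> real"
  assumes "n \<ge> 2"
    and "planar_configuration n m q"
    and "central_configuration_with n m q lam"
    and "balanced n m q"
    and "collisionless n q"
    and "\<forall>j\<in>{1..n}. \<forall>t. x j t = rigid_motion lam q j t"
    and "\<forall>i. s i = norm (q i)"
    and "Emin = - (\<Sum>i=1..n. m i / s i)"
    and "Tmin = 2 * pi * (\<Sum>i=1..n. m i / s i ^ 3) powr (-1/2)"
    and "\<forall>E\<in>{Emin<..<0}. T0 E = minimal_period n m s E"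
  shows "(\<forall>E\<in>{Emin<..<0}.
            (\<exists>!zE. zE > 0 \<and> - (\<Sum>i=1..n. m i * ((s i)\<^sup>2 + zE\<^sup>2) powr (-1/2)) = E) \<and>
            (\<forall>zE. zE > 0 \<and> - (\<Sum>i=1..n. m i * ((s i)\<^sup>2 + zE\<^sup>2) powr (-1/2)) = E \<longrightarrow>
               (\<lambda>z. (E + (\<Sum>i=1..n. m i * ((s i)\<^sup>2 + z\<^sup>2) powr (-1/2))) powr (-1/2))
                 integrable_on {0..zE} \<and>
               T0 E = 2 powr (3/2) *
                 integral {0..zE}
                   (\<lambda>z. (E + (\<Sum>i=1..n. m i * ((s i)\<^sup>2 + z\<^sup>2) powr (-1/2))) powr (-1/2)))) \<and>
         strict_mono_on {Emin<..<0} T0 \<and>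
         T0 ` {Emin<..<0} = {Tmin<..}"
proof -
  interpret axis_potential n m s
    using assms by unfold_locales (auto simp: planar_configuration_def collisionless_def)
  have Emin: "Emin = - pot 0"
    using assms(8) by (simp add: pot_def)
  have T0: "T0 (- pot a) = 4 * quarter a" if "a > 0" for a
    using that assms(10) minimal_period_eq pot_strict_antimono[of 0 a] pot_pos[of a]
    by (simp add: Emin)
  \<comment> \<open>Together with \<open>T0\<close>, this lets \<open>E = - pot a\<close>, which
    increases with \<open>a > 0\<close>, carry the claims over to \<open>quarter\<close>.\<close>
  have amplitude: "\<exists>a>0. E = - pot a" if E: "E \<in> {Emin<..<0}" for E
  proof -
    obtain a where "a > 0" "pot a = - E"
      using ex1_implies_ex[OF ex1_amplitude[of "- E"]] E by (auto simp: Emin)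
    then show ?thesis by (intro exI[of _ a]) simp
  qed
  have "(\<exists>!a. a > 0 \<and> - pot a = E) \<and>
      (\<forall>a. a > 0 \<and> - pot a = E \<longrightarrow>
        (\<lambda>z. (E + pot z) powr (-1/2)) integrable_on {0..a} \<and>
        T0 E = 2 powr (3/2) * integral {0..a} (\<lambda>z. (E + pot z) powr (-1/2)))"
    if E: "E \<in> {Emin<..<0}" for E
  proof (intro conjI allI impI)
    have "(- pot a = E) = (pot a = - E)" for a by auto
    then show "\<exists>!a. a > 0 \<and> - pot a = E"
      using ex1_amplitude[of "- E"] E by (simp add: Emin)
    fix a assume a: "a > 0 \<and> - pot a = E"
    have int: "((\<lambda>z. (E + pot z) powr (-1/2)) has_integral (sqrt 2 * quarter a)) {0..a}"
      using quarter_has_integral[of a] a by (simp add: add.commute diff_conv_add_uminus del: add_uminus_conv_diff)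
    then show "(\<lambda>z. (E + pot z) powr (-1/2)) integrable_on {0..a}" by blast
    \<comment> \<open>The prefactor \<open>2 powr (3/2)\<close> and the \<open>sqrt 2\<close> from
      the integral multiply to 4, one for each quarter.\<close>
    have "4 * quarter a = 2 powr (3/2) * (sqrt 2 * quarter a)"
      by (simp add: powr_three_halves power3_eq_cube)
    then show "T0 E = 2 powr (3/2) * integral {0..a} (\<lambda>z. (E + pot z) powr (-1/2))"
      using T0[of a] a int by (simp add: integral_unique)
  qed
  moreover have "strict_mono_on {Emin<..<0} T0"
  proof (rule strict_mono_onI)
    fix E E' assume "E \<in> {Emin<..<0}" "E' \<in> {Emin<..<0}" "E < E'"
    then obtain a b where ab: "a > 0" "b > 0" "E = - pot a" "E' = - pot b" "pot b < pot a"
      using amplitude by (metis neg_less_iff_less)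
    then have "a < b"
      using pot_strict_antimono[of b a] by (cases a b rule: linorder_cases) auto
    then show "T0 E < T0 E'" using ab T0 quarter_strict_mono[of a b] by simp
  qed
  moreover have "T0 ` {Emin<..<0} = {Tmin<..}"
  proof -
    have "{Emin<..<0} = (\<lambda>a. - pot a) ` {0<..}"
    proof (intro equalityI subsetI)
      fix E assume "E \<in> (\<lambda>a. - pot a) ` {0<..}"
      then obtain a where "a > 0" "E = - pot a" by auto
      then show "E \<in> {Emin<..<0}"
        using pot_strict_antimono[of 0 a] pot_pos[of a] by (simp add: Emin)
    qed (use amplitude in auto)
    then have "T0 ` {Emin<..<0} = (\<lambda>a. 4 * quarter a) ` {0<..}"
      using T0 by (simp add: image_image)
    moreover have "(\<Sum>i=1..n. m i / s i ^ 3) \<ge> 0"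
      by (intro sum_nonneg) (simp add: m_pos s_pos less_imp_le)
    then have "4 * quarter 0 = Tmin"
      by (simp add: quarter_0 assms(9) powr_minus_half)
    ultimately show ?thesis by (simp add: quarter_image)
  qed
  ultimately show ?thesis unfolding pot_powr by blast
qed

end
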